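(* Let $0\le t<1$ and let $f\in\mathcal{N}_t$ be normalized by $f(z)=z+a_2z^2+\cdots$, $z\in\mathbb{D}$. Then $$\operatorname{Re}\{a_2f(z)\}\ge-\frac12-\frac{t}{4(t+1)}\left[\left(\frac{1+|z|}{1-|z|}\right)^{\sqrt{1+t}}-1\right]^2$$ for all $z\in\mathbb{D}$.
   Context: $\mathbb{D}=\{z\in\mathbb{C}:|z|<1\}$. The Schwarzian derivative of a locally univalent function $f$ is $Sf=\left(\frac{f''}{f'}\right)'-\frac12\left(\frac{f''}{f'}\right)^2$. For $0\le t\le1$, the Nehari class $\mathcal{N}_t$ consists of the locally univalent analytic functions $f$ on $\mathbb{D}$ satisfying $|Sf(z)|\le\frac{2t}{(1-|z|^2)^2}$ for all $z\in\mathbb{D}$. *)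

theory Defs
  imports "HOL-Complex_Analysis.Complex_Analysis"
begin

abbreviation unit_disc :: "complex set" where
  "unit_disc \<equiv> ball 0 1"

definition locally_univalent_on :: "(complex \<Rightarrow> complex) \<Rightarrow> complex set \<Rightarrow> bool" where
  "locally_univalent_on f S \<longleftrightarrow>
     (\<forall>z\<in>S. \<exists>U. open U \<and> z \<in> U \<and> U \<subseteq> S \<and> inj_on f U)"

definition schwarzian :: "(complex \<Rightarrow> complex) \<Rightarrow> complex \<Rightarrow> complex" where
  "schwarzian f z =
     deriv (\<lambda>w. deriv (deriv f) w / deriv f w) z
       - 1 / 2 * (deriv (deriv f) z / deriv f z)\<^sup>2"

(* Elements are total functions; their values outside the unit disc are irrelevant,
   since the disc is open and all derivatives are taken at points inside it. *)
definition nehari_class :: "real \<Rightarrow> (complex \<Rightarrow> complex) set" where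
  "nehari_class t =
     {f. f analytic_on unit_disc \<and> locally_univalent_on f unit_disc \<and>
         (\<forall>z\<in>unit_disc. norm (schwarzian f z) \<le> 2 * t / (1 - (norm z)\<^sup>2)\<^sup>2)}"

end

theory Submission
  imports Defs
begin

text \<open>
  Put \<open>q = f'' / (2 f')\<close>, so that \<open>q' = Sf / 2 + q\<^sup>2\<close> and \<open>q 0 = a 2\<close>. Since
  \<open>2 Re (a 2 * f) + 1 = |1 + a 2 * f|\<^sup>2 - |a 2|\<^sup>2 |f|\<^sup>2\<close>, three estimates suffice:
  \<open>|a 2|\<^sup>2 \<le> 1 + t\<close>, \<open>|1 + a 2 * f|\<^sup>2 \<ge> (1 - t) |f|\<^sup>2\<close> and
  \<open>|f z| \<le> F |z|\<close>, where \<open>F\<close> is the extremal function with \<open>SF x = - 2 t / (1 - x\<^sup>2)\<^sup>2\<close>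
  and \<open>F'' 0 / 2 = sqrt (1 + t)\<close>.
  The first holds in the invariant form \<open>|(1 - |z|\<^sup>2) q z - cnj z| \<le> sqrt (1 + t)\<close>, by
  maximising the left-hand side over the closed disc; integrating this along radii gives the
  bound by \<open>F\<close>. The second says that \<open>f / (1 + a 2 * f)\<close>, whose second derivative vanishes
  at \<open>0\<close>, is bounded by \<open>1 / sqrt (1 - t)\<close>, which is a Sturm comparison along radii.
\<close>

section \<open>Derivatives of moduli along real curves and rays\<close>

lemma has_real_derivative_norm_power2:
  fixes F :: "real \<Rightarrow> complex"
  assumes "(F has_vector_derivative F') (at x)"
  shows "((\<lambda>x. (norm (F x))\<^sup>2) has_real_derivative 2 * Re (cnj (F x) * F')) (at x)"
proof -
  have "((\<lambda>x. F x \<bullet> F x) has_derivative (\<lambda>h. F x \<bullet> (h *\<^sub>R F') + (h *\<^sub>R F') \<bullet> F x)) (at x)"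
    using assms unfolding has_vector_derivative_def by (intro has_derivative_inner)
  moreover have "(\<lambda>h. F x \<bullet> (h *\<^sub>R F') + (h *\<^sub>R F') \<bullet> F x) = (*) (2 * Re (cnj (F x) * F'))"
    by (auto simp: inner_complex_def algebra_simps)
  ultimately show ?thesis
    by (simp add: has_field_derivative_def dot_square_norm)
qed

text \<open>Square root of the previous rule. The logarithmic form is chosen because the later
  comparisons control only the quotient \<open>F' / F\<close>.\<close>

lemma has_real_derivative_norm:
  fixes F :: "real \<Rightarrow> complex"
  assumes "(F has_vector_derivative F') (at x)" "F x \<noteq> 0"
  shows "((\<lambda>x. norm (F x)) has_real_derivative norm (F x) * Re (F' / F x)) (at x)"
proof -
  have eq: "Re (F' / F x) = Re (cnj (F x) * F') / (norm (F x))\<^sup>2"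
    by (simp add: Re_divide cmod_power2 algebra_simps)
  have "((\<lambda>x. sqrt ((norm (F x))\<^sup>2)) has_real_derivative
      inverse (sqrt ((norm (F x))\<^sup>2)) / 2 * (2 * Re (cnj (F x) * F'))) (at x)"
    using assms by (intro DERIV_chain2[OF DERIV_real_sqrt] has_real_derivative_norm_power2) auto
  moreover have "inverse (sqrt ((norm (F x))\<^sup>2)) / 2 * (2 * Re (cnj (F x) * F')) = norm (F x) * Re (F' / F x)"
    using assms(2) unfolding eq by (simp add: power2_eq_square divide_simps)
  ultimately show ?thesis
    by simp
qed

lemma has_vector_derivative_line:
  fixes z e :: complex
  assumes "(g has_field_derivative g') (at (z + of_real x * e))"
  shows "((\<lambda>x. g (z + of_real x * e)) has_vector_derivative e * g') (at x)"
proof -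
  have "((\<lambda>x. z + complex_of_real x * e) has_vector_derivative e) (at x)"
    by (auto intro!: derivative_eq_intros)
  from field_vector_diff_chain_at[OF this assms] show ?thesis
    by (simp add: o_def)
qed

lemmas has_vector_derivative_ray = has_vector_derivative_line[where z = 0, simplified]

section \<open>The invariant Riccati bound on half the pre-Schwarzian derivative\<close>

text \<open>
  At an interior maximum of \<open>|A|\<close>, where \<open>A z = (1 - |z|\<^sup>2) q z - cnj z\<close>, the derivative
  of \<open>|A|\<^sup>2\<close> in direction \<open>e\<close> is \<open>2 Re (e * B)\<close> with
  \<open>B = \<delta> * p * cnj A + A (|A|\<^sup>2 - 1) / \<delta>\<close>, \<open>\<delta> = 1 - |z|\<^sup>2\<close>. Hence \<open>B = 0\<close> and
  \<open>||A|\<^sup>2 - 1| = \<delta>\<^sup>2 |p| \<le> t\<close> unless \<open>A = 0\<close>. On the boundary \<open>|A| = 1\<close>.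
\<close>

lemma riccati_bound_closed_disc:
  fixes p q :: "complex \<Rightarrow> complex"
  assumes q: "\<And>z. z \<in> ball 0 1 \<Longrightarrow> (q has_field_derivative p z + (q z)\<^sup>2) (at z)"
    and cont: "continuous_on (cball 0 1) q"
    and p: "\<And>z. z \<in> ball 0 1 \<Longrightarrow> norm (p z) \<le> t / (1 - (norm z)\<^sup>2)\<^sup>2"
    and t: "0 \<le> t" and w: "w \<in> ball 0 1"
  shows "norm (of_real (1 - (norm w)\<^sup>2) * q w - cnj w) \<le> sqrt (1 + t)"
proof -
  define A where "A z = of_real (1 - (norm z)\<^sup>2) * q z - cnj z" for z
  have "continuous_on (cball 0 1) (\<lambda>z. norm (A z))"
    unfolding A_def by (intro continuous_intros cont)
  then obtain z where z: "z \<in> cball 0 1" and max: "\<And>y. y \<in> cball 0 1 \<Longrightarrow> norm (A y) \<le> norm (A z)"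
    using continuous_attains_sup[OF compact_cball, of 0 1 "\<lambda>z. norm (A z)"] by (metis cball_eq_empty not_one_less_zero)
  have "(norm (A z))\<^sup>2 \<le> 1 + t"
  proof (cases "norm z = 1")
    case True
    then show ?thesis using t by (simp add: A_def)
  next
    case False
    with z have z1: "norm z < 1" by simp
    define \<delta> where "\<delta> = 1 - (norm z)\<^sup>2"
    have \<delta>: "\<delta> > 0" using z1 by (simp add: \<delta>_def power_less_one_iff abs_square_less_1)
    define B where "B = of_real \<delta> * p z * cnj (A z) + A z * of_real ((norm (A z))\<^sup>2 - 1) / of_real \<delta>"
    \<comment> \<open>The direction of steepest ascent: with this choice the directional derivative
      2 Re (\<open>e * B\<close>) becomes 2 |B|^2, so its vanishing forces
      \<open>B = 0\<close>.\<close>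
    define e where "e = cnj B"
    define A' where "A' = of_real (- 2 * Re (cnj z * e)) * q z + of_real \<delta> * (e * (p z + (q z)\<^sup>2)) - cnj e"
    have line: "((\<lambda>x. z + of_real x * e) has_vector_derivative e) (at 0)"
      by (auto intro!: derivative_eq_intros)
    have "((\<lambda>x. A (z + of_real x * e)) has_vector_derivative A') (at 0)"
    proof -
      have 1: "((\<lambda>x. (norm (z + of_real x * e))\<^sup>2) has_real_derivative 2 * Re (cnj z * e)) (at 0)"
        using has_real_derivative_norm_power2[OF line] by simp
      have 2: "((\<lambda>x. complex_of_real (1 - (norm (z + of_real x * e))\<^sup>2)) has_vector_derivative of_real (- 2 * Re (cnj z * e))) (at 0)"
        by (rule bounded_linear.has_vector_derivative[OF bounded_linear_of_real],
            unfold has_real_derivative_iff_has_vector_derivative[symmetric])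
          (use DERIV_diff[OF DERIV_const 1, of 1] in simp)
      have 3: "((\<lambda>x. q (z + of_real x * e)) has_vector_derivative e * (p z + (q z)\<^sup>2)) (at 0)"
        using q[of z] z1 by (intro has_vector_derivative_line) auto
      have 4: "((\<lambda>x. cnj (z + of_real x * e)) has_vector_derivative cnj e) (at 0)"
        using line by (rule has_vector_derivative_cnj)
      show ?thesis
        unfolding A_def A'_def
        using has_vector_derivative_diff[OF has_vector_derivative_mult[OF 2 3] 4]
        by (simp add: \<delta>_def algebra_simps)
    qed
    from has_real_derivative_norm_power2[OF this]
    have der: "((\<lambda>x. (norm (A (z + of_real x * e)))\<^sup>2) has_real_derivative 2 * Re (cnj (A z) * A')) (at 0)"
      by simp
    have "open {x::real. z + of_real x * e \<in> ball 0 1}"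
      by (intro open_Collect_less continuous_intros open_vimage[unfolded vimage_def]) (auto intro!: continuous_intros)
    moreover have "0 \<in> {x::real. z + of_real x * e \<in> ball 0 1}" using z1 by simp
    ultimately obtain d where d: "d > 0" "ball 0 d \<subseteq> {x::real. z + of_real x * e \<in> ball 0 1}"
      by (meson openE)
    have "2 * Re (cnj (A z) * A') = 0"
    proof (rule DERIV_local_max[OF der d(1)], intro allI impI)
      fix y :: real assume "\<bar>0 - y\<bar> < d"
      then have "y \<in> ball 0 d" by (simp add: dist_norm)
      then have "z + of_real y * e \<in> cball 0 1" using d by force
      then show "(norm (A (z + of_real y * e)))\<^sup>2 \<le> (norm (A (z + of_real 0 * e)))\<^sup>2"
        using max by (simp add: power_mono)
    qed
    moreover have "Re (cnj (A z) * A') = Re (e * B)"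
    proof -
      have zz: "of_real \<delta> = 1 - z * cnj z"
        by (simp add: \<delta>_def complex_norm_square[symmetric])
      have "of_real \<delta> * q z = A z + cnj z"
        by (simp add: A_def \<delta>_def)
      then have qz: "q z = (A z + cnj z) / of_real \<delta>"
        using \<delta> by (simp add: field_simps)
      have e1: "complex_of_real (- 2 * Re (cnj z * e)) = - (cnj z * e + z * cnj e)"
        by (simp add: complex_eq_iff)
      have 5: "cnj (A z) * A' = e * (of_real \<delta> * p z * cnj (A z) + A z * cnj (A z) * q z) - cnj e * (cnj (A z) * (1 + z * q z))"
      proof -
        have "A' = - (cnj z * e + z * cnj e) * q z + of_real \<delta> * (e * (p z + (q z)\<^sup>2)) - cnj e"
          unfolding A'_def e1 ..
        also have "\<dots> = e * (of_real \<delta> * p z + (of_real \<delta> * q z - cnj z) * q z) - cnj e * (1 + z * q z)"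
          by (simp add: algebra_simps power2_eq_square)
        also have "of_real \<delta> * q z - cnj z = A z" by (simp add: A_def \<delta>_def)
        finally have A'_eq: "A' = e * (of_real \<delta> * p z + A z * q z) - cnj e * (1 + z * q z)" .
        show ?thesis unfolding A'_eq by (simp add: algebra_simps)
      qed
      \<comment> \<open>Conjugation leaves real parts unchanged. It turns the term carrying
        \<open>cnj e\<close> into one carrying \<open>e\<close>, so that the whole derivative is the
        real part of \<open>e\<close> times a single factor.\<close>
      have "Re (cnj e * (cnj (A z) * (1 + z * q z))) = Re (cnj (cnj e * (cnj (A z) * (1 + z * q z))))"
        by (rule cnj.sel(1)[symmetric])
      also have "cnj (cnj e * (cnj (A z) * (1 + z * q z))) = e * (A z * cnj (1 + z * q z))"
        by simp
      finally have "Re (cnj (A z) * A') = Re (e * (of_real \<delta> * p z * cnj (A z) + A z * cnj (A z) * q z) - e * (A z * cnj (1 + z * q z)))"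
        unfolding 5 by (simp only: minus_complex.sel)
      also have "of_real \<delta> * p z * cnj (A z) + A z * cnj (A z) * q z - A z * cnj (1 + z * q z) = B"
      proof -
        have "1 + z * q z = (1 + z * A z) / of_real \<delta>"
        proof -
          have "1 + z * q z = (of_real \<delta> + z * (A z + cnj z)) / of_real \<delta>"
            unfolding qz using \<delta> by (simp add: field_simps)
          also have "of_real \<delta> + z * (A z + cnj z) = 1 + z * A z"
            by (simp add: zz algebra_simps)
          finally show ?thesis .
        qed
        then have cz: "cnj (1 + z * q z) = (1 + cnj z * cnj (A z)) / of_real \<delta>"
          by simp
        show ?thesis
          using \<delta> unfolding cz unfolding B_def qz of_real_diff complex_norm_square by (simp add: field_simps)
      qed
      then have "e * (of_real \<delta> * p z * cnj (A z) + A z * cnj (A z) * q z) - e * (A z * cnj (1 + z * q z)) = e * B"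
        by (simp add: algebra_simps)
      finally show ?thesis by simp
    qed
    moreover have "Re (e * B) = (norm B)\<^sup>2"
      unfolding cmod_power2 by (simp add: e_def power2_eq_square)
    ultimately have "(norm B)\<^sup>2 = 0" by linarith
    then have "B = 0" by simp
    show ?thesis
    proof (cases "A z = 0")
      case True then show ?thesis using t by simp
    next
      case False
      \<comment> \<open>The equation \<open>B = 0\<close> multiplied by \<open>\<delta>\<close>.
        Taking moduli and cancelling |A| then leaves an identity for | |A|^2 - 1 |.\<close>
      have "A z * of_real ((norm (A z))\<^sup>2 - 1) = - (of_real (\<delta>\<^sup>2) * p z * cnj (A z))"
        using \<open>B = 0\<close> \<delta> by (simp add: B_def power2_eq_square field_simps add_eq_0_iff)
      then have "norm (A z) * \<bar>(norm (A z))\<^sup>2 - 1\<bar> = \<delta>\<^sup>2 * norm (p z) * norm (A z)"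
        by (metis (no_types, opaque_lifting) complex_mod_cnj norm_minus_cancel norm_mult norm_of_real abs_power2)
      then have "\<bar>(norm (A z))\<^sup>2 - 1\<bar> = \<delta>\<^sup>2 * norm (p z)" using False by simp
      also have "\<dots> \<le> \<delta>\<^sup>2 * (t / \<delta>\<^sup>2)"
        using p[of z] z1 by (intro mult_left_mono) (auto simp: \<delta>_def)
      also have "\<dots> = t" using \<delta> by simp
      finally show ?thesis by linarith
    qed
  qed
  then have "norm (A z) \<le> sqrt (1 + t)" by (rule real_le_rsqrt)
  moreover have "norm (A w) \<le> norm (A z)" using w by (intro max) auto
  ultimately show ?thesis unfolding A_def by linarith
qed

text \<open>Continuity up to the boundary is gained by dilation: \<open>R * q (R * z)\<close> solves
  the Riccati equation with \<open>R\<^sup>2 * p (R * z)\<close> in place of \<open>p\<close>, obeys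
  the same bound on that coefficient, and is continuous on the closed disc for R < 1. Letting R tend
  to 1 gives the claim.\<close>

lemma riccati_bound_disc:
  fixes p q :: "complex \<Rightarrow> complex"
  assumes q: "\<And>z. z \<in> ball 0 1 \<Longrightarrow> (q has_field_derivative p z + (q z)\<^sup>2) (at z)"
    and p: "\<And>z. z \<in> ball 0 1 \<Longrightarrow> norm (p z) \<le> t / (1 - (norm z)\<^sup>2)\<^sup>2"
    and t: "0 \<le> t" and w: "w \<in> ball 0 1"
  shows "norm (of_real (1 - (norm w)\<^sup>2) * q w - cnj w) \<le> sqrt (1 + t)"
proof -
  have contq: "continuous_on (ball 0 1) q"
    using q by (meson DERIV_isCont continuous_at_imp_continuous_on)
  have dilate: "norm (of_real (1 - (norm w)\<^sup>2) * (of_real R * q (of_real R * w)) - cnj w) \<le> sqrt (1 + t)"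
    if R: "0 < R" "R < 1" for R :: real
  proof -
    have mem: "of_real R * z \<in> ball 0 1" if "z \<in> cball 0 1" for z :: complex
    proof -
      have "R * norm z \<le> R * 1" using that R by (intro mult_left_mono) auto
      also have "\<dots> < 1" using R by simp
      finally show ?thesis using R by (simp add: norm_mult)
    qed
    show ?thesis
    proof (rule riccati_bound_closed_disc[where p = "\<lambda>z. of_real (R\<^sup>2) * p (of_real R * z)"
          and q = "\<lambda>z. of_real R * q (of_real R * z)"])
      fix z :: complex assume z: "z \<in> ball 0 1"
      then have Rz: "of_real R * z \<in> ball 0 1" by (intro mem) auto
      have "((\<lambda>z. q (of_real R * z)) has_field_derivative (p (of_real R * z) + (q (of_real R * z))\<^sup>2) * of_real R) (at z)"
        by (rule DERIV_chain2[where f = q and g = "\<lambda>z. of_real R * z", OF q[OF Rz]]) (auto intro!: derivative_eq_intros)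
      from DERIV_cmult[OF this, of "of_real R"]
      show "((\<lambda>z. of_real R * q (of_real R * z)) has_field_derivative
          of_real (R\<^sup>2) * p (of_real R * z) + (of_real R * q (of_real R * z))\<^sup>2) (at z)"
        by (rule DERIV_cong) (simp add: power2_eq_square algebra_simps)
      define x where "x = (norm z)\<^sup>2"
      have x: "0 \<le> x" "x < 1" using z by (auto simp: x_def abs_square_less_1)
      \<comment> \<open>The difference of the two sides is (1 - R)(1 + R x). After squaring, this is
        the Schwarz-Pick type inequality that keeps the bound on \<open>p\<close> intact under
        dilation.\<close>
      have "R * (1 - x) \<le> 1 - R\<^sup>2 * x"
      proof -
        have "0 \<le> (1 - R) * (1 + R * x)" using R x by auto
        then show ?thesis by (simp add: algebra_simps power2_eq_square)
      qed
      moreover have "0 < R * (1 - x)" using R x by simp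
      ultimately have "(R * (1 - x))\<^sup>2 \<le> (1 - R\<^sup>2 * x)\<^sup>2" "0 < (R * (1 - x))\<^sup>2"
        by (auto intro!: power_mono)
      then have "t / (1 - R\<^sup>2 * x)\<^sup>2 \<le> t / (R * (1 - x))\<^sup>2"
        using t by (intro divide_left_mono) (simp_all only: mult_pos_pos less_le_trans)
      moreover have "norm (p (of_real R * z)) \<le> t / (1 - R\<^sup>2 * x)\<^sup>2"
        using p[OF Rz] R by (simp add: norm_mult power_mult_distrib x_def)
      ultimately have "R\<^sup>2 * norm (p (of_real R * z)) \<le> R\<^sup>2 * (t / (R * (1 - x))\<^sup>2)"
        by (intro mult_left_mono) auto
      then show "norm (of_real (R\<^sup>2) * p (of_real R * z)) \<le> t / (1 - (norm z)\<^sup>2)\<^sup>2"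
        using R by (simp add: norm_mult power_mult_distrib x_def norm_power)
    next
      show "continuous_on (cball 0 1) (\<lambda>z. of_real R * q (of_real R * z))"
        by (intro continuous_intros continuous_on_compose2[OF contq]) (use mem in auto)
    qed (use t w in auto)
  qed
  have "((\<lambda>R. norm (of_real (1 - (norm w)\<^sup>2) * (of_real R * q (of_real R * w)) - cnj w)) \<longlongrightarrow>
      norm (of_real (1 - (norm w)\<^sup>2) * (of_real 1 * q (of_real 1 * w)) - cnj w)) (at_left (1::real))"
    by (intro tendsto_intros isCont_tendsto_compose[of _ q] DERIV_isCont[OF q]) (use w in auto)
  moreover have "\<forall>\<^sub>F R in at_left (1::real). norm (of_real (1 - (norm w)\<^sup>2) * (of_real R * q (of_real R * w)) - cnj w) \<le> sqrt (1 + t)"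
    using eventually_at_left_real[OF zero_less_one] by (rule eventually_mono) (use dilate in auto)
  ultimately have "norm (of_real (1 - (norm w)\<^sup>2) * (of_real 1 * q (of_real 1 * w)) - cnj w) \<le> sqrt (1 + t)"
    by (intro tendsto_upperbound) auto
  then show ?thesis by simp
qed

section \<open>Growth of |f| along radii\<close>

lemma complex_polar_unit:
  obtains e :: complex where "norm e = 1" "w = of_real (norm w) * e"
  by (rule that[of "if w = 0 then 1 else w / of_real (norm w)"]) (auto simp: norm_divide)

text \<open>The bound on \<open>q\<close> limits the radial logarithmic derivative of |d| by 2 (x +
  s) / (1 - x^2). Integrating once bounds |d| by the derivative of the extremal function, and
  integrating again bounds |f|.\<close>

lemma norm_le_growth:
  fixes f d q :: "complex \<Rightarrow> complex"
  assumes f: "\<And>z. z \<in> ball 0 1 \<Longrightarrow> (f has_field_derivative d z) (at z)"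
    and d: "\<And>z. z \<in> ball 0 1 \<Longrightarrow> (d has_field_derivative 2 * q z * d z) (at z)"
    and d0: "\<And>z. z \<in> ball 0 1 \<Longrightarrow> d z \<noteq> 0"
    and q: "\<And>z. z \<in> ball 0 1 \<Longrightarrow> norm (of_real (1 - (norm z)\<^sup>2) * q z - cnj z) \<le> s"
    and norm: "f 0 = 0" "d 0 = 1" and s: "s > 0" and w: "w \<in> ball 0 1"
  shows "norm (f w) \<le> (((1 + norm w) / (1 - norm w)) powr s - 1) / (2 * s)"
proof -
  obtain e where e: "norm e = 1" "w = of_real (norm w) * e"
    by (rule complex_polar_unit)
  define r where "r = norm w"
  have r: "0 \<le> r" "r < 1" using w by (auto simp: r_def)
  have ray: "of_real x * e \<in> ball 0 1" if "0 \<le> x" "x \<le> r" for x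
    using that r e by (simp add: norm_mult)
  \<comment> \<open>An integrating factor: its logarithmic derivative is -2 (x + s) / (1 - x^2),
    exactly opposite to the largest possible one for |d|.\<close>
  define \<phi> where "\<phi> x = (1 - x\<^sup>2) * exp (- 2 * s * artanh x)" for x :: real
  \<comment> \<open>A primitive of \<open>1 / \<phi>\<close>. As artanh is half a logarithm, the
    exponential is the power of (1 + x) / (1 - x) in the claim, and subtracting \<open>F 0\<close>
    gives the -1.\<close>
  define F where "F x = exp (2 * s * artanh x) / (2 * s)" for x :: real
  have pos: "\<phi> x > 0" if "0 \<le> x" "x < 1" for x
    using that by (simp add: \<phi>_def abs_square_less_1)
  have d_le: "norm (d (of_real x * e)) * \<phi> x \<le> 1" if x: "0 \<le> x" "x \<le> r" for x
  proof -
    have "norm (d (of_real x * e)) * \<phi> x \<le> norm (d (of_real 0 * e)) * \<phi> 0"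
    proof (rule DERIV_nonpos_imp_nonincreasing[OF x(1)])
      fix y assume y: "0 \<le> y" "y \<le> x"
      then have y1: "0 \<le> y" "y < 1" and b: "of_real y * e \<in> ball 0 1" using x r ray[of y] by auto
      have 1: "((\<lambda>x. norm (d (of_real x * e))) has_real_derivative
          norm (d (of_real y * e)) * Re (e * (2 * q (of_real y * e) * d (of_real y * e)) / d (of_real y * e))) (at y)"
        by (intro has_real_derivative_norm has_vector_derivative_ray d d0 b)
      have 2: "(\<phi> has_real_derivative - (\<phi> y * (2 * (y + s) / (1 - y\<^sup>2)))) (at y)"
      proof -
        have y2: "1 - y\<^sup>2 \<noteq> 0" using y1 by (simp add: power2_eq_1_iff)
        have "((\<lambda>x. exp (- 2 * s * artanh x)) has_real_derivative
            exp (- 2 * s * artanh y) * (- 2 * s * (1 / (1 - y\<^sup>2)))) (at y)"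
          using y1 by (auto intro!: derivative_eq_intros)
        moreover have "((\<lambda>x. 1 - x\<^sup>2) has_real_derivative - (2 * y)) (at y)"
          by (auto intro!: derivative_eq_intros)
        ultimately have "(\<phi> has_real_derivative - (2 * y) * exp (- 2 * s * artanh y) +
            exp (- 2 * s * artanh y) * (- 2 * s * (1 / (1 - y\<^sup>2))) * (1 - y\<^sup>2)) (at y)"
          unfolding \<phi>_def by (rule DERIV_mult[rotated])
        then show ?thesis
          by (rule DERIV_cong) (use y2 in \<open>simp add: \<phi>_def divide_simps\<close>, simp add: algebra_simps)
      qed
      \<comment> \<open>Multiplication by the unit number \<open>e\<close> turns
        \<open>cnj z\<close> at \<open>z = y * e\<close> into the real number \<open>y\<close>, so
        the hypothesis on \<open>q\<close> bounds the radial component by y + s.\<close>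
      have "Re (e * (2 * q (of_real y * e))) \<le> 2 * (y + s) / (1 - y\<^sup>2)"
      proof -
        have y2: "y\<^sup>2 < 1" using y1 by (simp add: abs_square_less_1)
        have "Re (e * (of_real (1 - y\<^sup>2) * q (of_real y * e) - cnj (of_real y * e))) \<le> s"
          using complex_Re_le_cmod[of "e * (of_real (1 - y\<^sup>2) * q (of_real y * e) - cnj (of_real y * e))"] q[OF b] y1 e
          by (simp add: norm_mult)
        also have "e * (of_real (1 - y\<^sup>2) * q (of_real y * e) - cnj (of_real y * e)) =
            of_real (1 - y\<^sup>2) * (e * q (of_real y * e)) - of_real y"
          using e(1) complex_norm_square[of e] by (simp add: algebra_simps)
        finally have "(1 - y\<^sup>2) * Re (e * q (of_real y * e)) \<le> y + s" by simp
        then show ?thesis using y2 by (simp add: field_simps)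
      qed
      then have "norm (d (of_real y * e)) * Re (e * (2 * q (of_real y * e))) * \<phi> y \<le>
          norm (d (of_real y * e)) * (2 * (y + s) / (1 - y\<^sup>2)) * \<phi> y"
        using pos[OF y1] by (intro mult_right_mono mult_left_mono) auto
      then have "norm (d (of_real y * e)) * Re (e * (2 * q (of_real y * e) * d (of_real y * e)) / d (of_real y * e)) * \<phi> y
          + - (\<phi> y * (2 * (y + s) / (1 - y\<^sup>2))) * norm (d (of_real y * e)) \<le> 0"
        using d0[OF b] by (simp add: mult_ac)
      with DERIV_mult[OF 1 2] show "\<exists>l. ((\<lambda>x. norm (d (of_real x * e)) * \<phi> x) has_real_derivative l) (at y) \<and> l \<le> 0"
        by blast
    qed
    then show ?thesis using norm by (simp add: \<phi>_def)
  qed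
  have F: "(F has_real_derivative 1 / \<phi> x) (at x)" if "0 \<le> x" "x < 1" for x
  proof -
    have "(F has_real_derivative exp (2 * s * artanh x) * (2 * s * (1 / (1 - x\<^sup>2))) / (2 * s)) (at x)"
      unfolding F_def using that s by (auto intro!: derivative_eq_intros)
    then show ?thesis
      by (rule DERIV_cong) (use s in simp, simp add: \<phi>_def exp_minus divide_inverse mult_ac)
  qed
  \<comment> \<open>Mean value inequality with majorant \<open>F\<close>. It is applied on a
    nondegenerate interval, hence the separate case \<open>r = 0\<close>.\<close>
  have "norm (f (of_real r * e) - f (of_real 0 * e)) \<le> F r - F 0"
  proof (cases "r = 0")
    case False
    with r have "0 < r" by simp
    then show ?thesis
    proof (rule differentiable_bound_general)
      show "continuous_on {0..r} F"
        using F r by (intro continuous_at_imp_continuous_on) (force intro: DERIV_isCont)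
      have "((\<lambda>x. f (of_real x * e)) has_vector_derivative e * d (of_real x * e)) (at x)" if "0 \<le> x" "x \<le> r" for x
        by (intro has_vector_derivative_ray f ray that)
      note f' = this
      show "continuous_on {0..r} (\<lambda>x. f (of_real x * e))"
        by (intro continuous_at_imp_continuous_on ballI, rule has_vector_derivative_continuous[OF f']) auto
      fix x assume x: "0 < x" "x < r"
      then show "((\<lambda>x. f (of_real x * e)) has_vector_derivative e * d (of_real x * e)) (at x)" by (intro f') auto
      show "(F has_vector_derivative 1 / \<phi> x) (at x)" 
        using F[of x] x r by (simp add: has_real_derivative_iff_has_vector_derivative)
      show "norm (e * d (of_real x * e)) \<le> 1 / \<phi> x"
        using d_le[of x] pos[of x] x r e by (simp add: norm_mult field_simps)
    qed
  qed simp
  moreover have "exp (2 * s * artanh r) = ((1 + r) / (1 - r)) powr s"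
    using r by (simp add: powr_def artanh_def)
  ultimately show ?thesis
    using norm e(2) by (simp add: F_def r_def diff_divide_distrib)
qed

section \<open>Sturm comparison for f / (1 + q(0) f)\<close>

text \<open>
  \<open>L\<close> is the modulus along the radius of the solution \<open>u = (1 + q 0 * f) / sqrt d\<close> of
  \<open>u'' + p * u = 0\<close>, and \<open>E = L' / L\<close>; it is compared with the positive solution \<open>U\<close> of
  \<open>U'' + t / (1 - x\<^sup>2)\<^sup>2 * U = 0\<close>, where \<open>V = U' / U\<close>. Both start at \<open>1\<close> with slope \<open>0\<close>.
\<close>

lemma sturm_radial_bound:
  fixes f d p q :: "complex \<Rightarrow> complex"
  assumes f: "\<And>z. z \<in> ball 0 1 \<Longrightarrow> (f has_field_derivative d z) (at z)"
    and d: "\<And>z. z \<in> ball 0 1 \<Longrightarrow> (d has_field_derivative 2 * q z * d z) (at z)"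
    and d0: "\<And>z. z \<in> ball 0 1 \<Longrightarrow> d z \<noteq> 0"
    and q: "\<And>z. z \<in> ball 0 1 \<Longrightarrow> (q has_field_derivative p z + (q z)\<^sup>2) (at z)"
    and p: "\<And>z. z \<in> ball 0 1 \<Longrightarrow> norm (p z) \<le> t / (1 - (norm z)\<^sup>2)\<^sup>2"
    and norm: "f 0 = 0" "d 0 = 1" and t: "t < 1"
    and e: "norm e = 1" and r: "0 \<le> r" "r < 1"
    and nz: "\<And>x. 0 \<le> x \<Longrightarrow> x \<le> r \<Longrightarrow> 1 + q 0 * f (of_real x * e) \<noteq> 0"
  shows "sqrt (1 - t) * norm (f (of_real r * e)) \<le> norm (1 + q 0 * f (of_real r * e))"
proof -
  define k where "k = sqrt (1 - t)"
  have k: "k > 0" "k\<^sup>2 = 1 - t" using t by (auto simp: k_def)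
  define m where "m z = 1 + q 0 * f z" for z
  \<comment> \<open>The logarithmic derivative u' / u of \<open>u = m / sqrt d\<close>. The equation
    u'' + p u = 0 becomes the Riccati equation Q' = -p - Q^2, and \<open>Q 0 = 0\<close>.\<close>
  define Q where "Q z = q 0 * d z / m z - q z" for z
  define E where "E x = Re (e * Q (of_real x * e))" for x
  define V where "V x = (k * tanh (k * artanh x) - x) / (1 - x\<^sup>2)" for x
  define L where "L x = norm (m (of_real x * e)) / sqrt (norm (d (of_real x * e)))" for x
  define U where "U x = sqrt (1 - x\<^sup>2) * cosh (k * artanh x)" for x
  \<comment> \<open>A primitive of \<open>1 / U\<^sup>2\<close> vanishing at 0. Its supremum 1 / k
    is the source of the constant \<open>sqrt (1 - t)\<close>.\<close>
  define T where "T x = tanh (k * artanh x) / k" for x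
  have ray: "of_real x * e \<in> ball 0 1" and sq: "1 - x\<^sup>2 > 0" if "0 \<le> x" "x \<le> r" for x
    using that r e by (auto simp: norm_mult abs_square_less_1)
  have m0: "m (of_real x * e) \<noteq> 0" if "0 \<le> x" "x \<le> r" for x
    using nz[OF that] by (simp add: m_def)
  have m: "(m has_field_derivative q 0 * d z) (at z)" if "z \<in> ball 0 1" for z
    unfolding m_def by (auto intro!: derivative_eq_intros f that)
  have L0: "L x > 0" and U0: "U x > 0" if "0 \<le> x" "x \<le> r" for x
    using m0[OF that] d0[OF ray[OF that]] sq[OF that] by (auto simp: L_def U_def cosh_real_pos)
  have dL: "(L has_real_derivative L x * E x) (at x)" if x: "0 \<le> x" "x \<le> r" for x
  proof -
    let ?z = "of_real x * e"
    have 1: "((\<lambda>x. norm (m (of_real x * e))) has_real_derivative norm (m ?z) * Re (e * (q 0 * d ?z) / m ?z)) (at x)"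
      by (intro has_real_derivative_norm has_vector_derivative_ray m ray m0 x)
    have "((\<lambda>x. norm (d (of_real x * e))) has_real_derivative norm (d ?z) * Re (e * (2 * q ?z * d ?z) / d ?z)) (at x)"
      by (intro has_real_derivative_norm has_vector_derivative_ray d d0 ray x)
    then have "((\<lambda>x. norm (d (of_real x * e))) has_real_derivative norm (d ?z) * (2 * Re (e * q ?z))) (at x)"
      by (rule DERIV_cong) (use d0[OF ray[OF x]] in simp)
    then have 2: "((\<lambda>x. sqrt (norm (d (of_real x * e)))) has_real_derivative
        inverse (sqrt (norm (d ?z))) / 2 * (norm (d ?z) * (2 * Re (e * q ?z)))) (at x)"
      by (intro DERIV_chain2[OF DERIV_real_sqrt]) (use d0[OF ray[OF x]] in auto)
    have "inverse (sqrt (norm (d ?z))) / 2 * (norm (d ?z) * (2 * Re (e * q ?z))) = sqrt (norm (d ?z)) * Re (e * q ?z)"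
      using d0[OF ray[OF x]] by (simp add: field_simps)
    note 2 = 2[unfolded this]
    have Ex: "E x = Re (e * (q 0 * d ?z) / m ?z) - Re (e * q ?z)"
      by (simp add: E_def Q_def right_diff_distrib del: times_complex.sel)
    show ?thesis
    proof -
      define X D A B where "X = norm (m ?z)" and "D = sqrt (norm (d ?z))"
        and "A = Re (e * (q 0 * d ?z) / m ?z)" and "B = Re (e * q ?z)"
      have "D \<noteq> 0" using d0[OF ray[OF x]] by (simp add: D_def)
      then have "((\<lambda>x. norm (m (of_real x * e)) / sqrt (norm (d (of_real x * e)))) has_real_derivative
          (X * A * D - X * (D * B)) / (D * D)) (at x)"
        using DERIV_divide[OF 1 2] unfolding X_def D_def A_def B_def by blast
      moreover have "(X * A * D - X * (D * B)) / (D * D) = X / D * (A - B)"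
        using \<open>D \<noteq> 0\<close> by (simp add: field_simps)
      ultimately show ?thesis
        unfolding L_def[abs_def] Ex X_def D_def A_def B_def by simp
    qed
  qed
  have dE: "(E has_real_derivative Re (e * (e * (- p (of_real x * e) - (Q (of_real x * e))\<^sup>2)))) (at x)"
    if x: "0 \<le> x" "x \<le> r" for x
  proof -
    let ?z = "of_real x * e"
    have "(Q has_field_derivative - p ?z - (Q ?z)\<^sup>2) (at ?z)"
    proof -
      have "(Q has_field_derivative (q 0 * (2 * q ?z * d ?z) * m ?z - q 0 * d ?z * (q 0 * d ?z)) / (m ?z * m ?z) - (p ?z + (q ?z)\<^sup>2)) (at ?z)"
        unfolding Q_def
        by (intro DERIV_diff DERIV_divide DERIV_cmult d m q ray m0 x)
      then show ?thesis
        by (rule DERIV_cong) (use m0[OF x] in \<open>simp add: Q_def power2_eq_square field_simps\<close>)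
    qed
    then have "((\<lambda>x. Q (of_real x * e)) has_vector_derivative e * (- p ?z - (Q ?z)\<^sup>2)) (at x)"
      by (rule has_vector_derivative_ray)
    then have "((\<lambda>x. e * Q (of_real x * e)) has_vector_derivative e * (e * (- p ?z - (Q ?z)\<^sup>2))) (at x)"
      by (rule has_vector_derivative_mult_right)
    from bounded_linear.has_vector_derivative[OF bounded_linear_Re this] show ?thesis
      unfolding E_def[abs_def] has_real_derivative_iff_has_vector_derivative .
  qed
  have dV: "(V has_real_derivative - t / (1 - x\<^sup>2)\<^sup>2 - (V x)\<^sup>2) (at x)" 
    and dU: "(U has_real_derivative U x * V x) (at x)"
    and dT: "(T has_real_derivative 1 / (U x)\<^sup>2) (at x)" if x: "0 \<le> x" "x \<le> r" for x
  proof -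
    have x1: "\<bar>x\<bar> < 1" using x r by auto
    have c: "cosh (k * artanh x) \<noteq> 0" by simp
    have tanh: "((\<lambda>x. tanh (k * artanh x)) has_real_derivative (1 - (tanh (k * artanh x))\<^sup>2) * (k / (1 - x\<^sup>2))) (at x)"
      using x1 by (auto intro!: derivative_eq_intros)
    have "(V has_real_derivative ((k * ((1 - (tanh (k * artanh x))\<^sup>2) * (k / (1 - x\<^sup>2))) - 1) * (1 - x\<^sup>2)
        - (k * tanh (k * artanh x) - x) * (- (2 * x))) / ((1 - x\<^sup>2) * (1 - x\<^sup>2))) (at x)"
      unfolding V_def using sq[OF x]
      by (intro DERIV_divide DERIV_diff DERIV_cmult tanh) (auto intro!: derivative_eq_intros)
    moreover have "((k * ((1 - (tanh (k * artanh x))\<^sup>2) * (k / (1 - x\<^sup>2))) - 1) * (1 - x\<^sup>2)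
        - (k * tanh (k * artanh x) - x) * (- (2 * x))) / ((1 - x\<^sup>2) * (1 - x\<^sup>2)) = - t / (1 - x\<^sup>2)\<^sup>2 - (V x)\<^sup>2"
    proof -
      define \<tau> where "\<tau> = tanh (k * artanh x)"
      \<comment> \<open>Computes the numerator of V'. Completing the square in
        \<open>k * \<tau> - x\<close> leaves k^2 - 1, which is -t by the choice of
        \<open>k\<close>.\<close>
      have "(k * ((1 - \<tau>\<^sup>2) * (k / (1 - x\<^sup>2))) - 1) * (1 - x\<^sup>2) = k\<^sup>2 * (1 - \<tau>\<^sup>2) - (1 - x\<^sup>2)"
        using sq[OF x] by (simp add: left_diff_distrib) (simp add: power2_eq_square right_diff_distrib)
      also have "\<dots> - (k * \<tau> - x) * (- (2 * x)) = - t - (k * \<tau> - x)\<^sup>2"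
        by (simp add: power2_diff power_mult_distrib k(2) algebra_simps) (simp add: power2_eq_square)
      finally have numerator: "(k * ((1 - \<tau>\<^sup>2) * (k / (1 - x\<^sup>2))) - 1) * (1 - x\<^sup>2)
          - (k * \<tau> - x) * (- (2 * x)) = - t - (k * \<tau> - x)\<^sup>2" .
      show ?thesis
        unfolding V_def power_divide \<tau>_def[symmetric] numerator
        by (simp add: diff_divide_distrib power2_eq_square[of "1 - x\<^sup>2"])
    qed
    ultimately show "(V has_real_derivative - t / (1 - x\<^sup>2)\<^sup>2 - (V x)\<^sup>2) (at x)" by simp
    have s: "((\<lambda>x. sqrt (1 - x\<^sup>2)) has_real_derivative - x / sqrt (1 - x\<^sup>2)) (at x)"
      using sq[OF x] by (auto intro!: derivative_eq_intros simp: field_simps)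
    have ch: "((\<lambda>x. cosh (k * artanh x)) has_real_derivative sinh (k * artanh x) * (k / (1 - x\<^sup>2))) (at x)"
      using x1 by (auto intro!: derivative_eq_intros)
    show "(U has_real_derivative U x * V x) (at x)"
    proof -
      define w where "w = sqrt (1 - x\<^sup>2)"
      have w: "w > 0" "1 - x\<^sup>2 = w * w" using sq[OF x] by (auto simp: w_def)
      have "- x / w * cosh (k * artanh x) + sinh (k * artanh x) * (k / (w * w)) * w
        = w * cosh (k * artanh x) * ((k * tanh (k * artanh x) - x) / (w * w))"
        using w(1) c by (simp add: tanh_def field_simps)
      then have "- x / sqrt (1 - x\<^sup>2) * cosh (k * artanh x) + sinh (k * artanh x) * (k / (1 - x\<^sup>2)) * sqrt (1 - x\<^sup>2)
        = U x * V x"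
        unfolding U_def V_def w_def[symmetric] unfolding w(2) .
      with DERIV_mult[OF s ch] show ?thesis
        unfolding U_def[abs_def] by simp
    qed
    have "((1 - (tanh (k * artanh x))\<^sup>2) * (k / (1 - x\<^sup>2))) / k = 1 / (U x)\<^sup>2"
    proof -
      have "1 - (tanh (k * artanh x))\<^sup>2 = 1 / (cosh (k * artanh x))\<^sup>2"
      proof -
        have "1 - (tanh (k * artanh x))\<^sup>2 = ((cosh (k * artanh x))\<^sup>2 - (sinh (k * artanh x))\<^sup>2) / (cosh (k * artanh x))\<^sup>2"
          using c by (simp add: tanh_def power_divide diff_divide_distrib)
        then show ?thesis by (simp only: hyperbolic_pythagoras)
      qed
      then show ?thesis using sq[OF x] k by (simp add: U_def power_mult_distrib)
    qed
    then show "(T has_real_derivative 1 / (U x)\<^sup>2) (at x)"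
      unfolding T_def using DERIV_cdivide[OF tanh, of k] by simp
  qed
  have EV: "V x \<le> E x" if x: "0 \<le> x" "x \<le> r" for x
  proof -
    \<comment> \<open>Subtracting the two Riccati relations gives (E - V)' \<ge> -(E + V)(E - V).
      Since L' = L E and U' = U V, the product \<open>L * U\<close> is an integrating factor, and
      both sides start at 0.\<close>
    have "(E 0 - V 0) * (L 0 * U 0) \<le> (E x - V x) * (L x * U x)"
    proof (rule DERIV_nonneg_imp_nondecreasing[OF x(1)])
      fix y assume "0 \<le> y" "y \<le> x"
      then have y: "0 \<le> y" "y \<le> r" using x by auto
      let ?z = "of_real y * e"
      let ?E' = "Re (e * (e * (- p ?z - (Q ?z)\<^sup>2)))" and ?V' = "- t / (1 - y\<^sup>2)\<^sup>2 - (V y)\<^sup>2"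
      have der: "((\<lambda>x. (E x - V x) * (L x * U x)) has_real_derivative
          (?E' - ?V') * (L y * U y) + (L y * E y * U y + U y * V y * L y) * (E y - V y)) (at y)"
        by (intro DERIV_mult DERIV_diff dE dV dL dU y)
      \<comment> \<open>Taking real parts of the complex Riccati equation loses only in the right
        direction, because Re (w^2) \<le> (Re w)^2.\<close>
      have "- t / (1 - y\<^sup>2)\<^sup>2 - (E y)\<^sup>2 \<le> ?E'"
      proof -
        have "norm (e * e * p ?z) \<le> t / (1 - y\<^sup>2)\<^sup>2"
          using p[OF ray[OF y]] e y by (simp add: norm_mult)
        then have "Re (e * e * p ?z) \<le> t / (1 - y\<^sup>2)\<^sup>2"
          using complex_Re_le_cmod order_trans by blast
        moreover have "Re ((e * Q ?z)\<^sup>2) \<le> (E y)\<^sup>2"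
          by (simp add: E_def Re_power2)
        moreover have "e * (e * (- p ?z - (Q ?z)\<^sup>2)) = - (e * e * p ?z) - (e * Q ?z)\<^sup>2"
          by (simp add: algebra_simps power2_eq_square)
        ultimately show ?thesis by (simp del: times_complex.sel)
      qed
      then have "0 \<le> (?E' - ?V' + ((E y)\<^sup>2 - (V y)\<^sup>2)) * (L y * U y)"
        using L0[OF y] U0[OF y] by (intro mult_nonneg_nonneg) auto
      also have "\<dots> = (?E' - ?V') * (L y * U y) + (L y * E y * U y + U y * V y * L y) * (E y - V y)"
        by (simp add: algebra_simps power2_eq_square)
      finally show "\<exists>l. ((\<lambda>x. (E x - V x) * (L x * U x)) has_real_derivative l) (at y) \<and> 0 \<le> l"
        using der by blast
    qed
    moreover have "E 0 = 0" "V 0 = 0"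
      using norm by (auto simp: E_def Q_def m_def V_def)
    ultimately have "0 \<le> (E x - V x) * (L x * U x)" by simp
    then show ?thesis using mult_pos_pos[OF L0[OF x] U0[OF x]] zero_le_mult_iff[of "E x - V x" "L x * U x"] by linarith
  qed
  have UL: "U x \<le> L x" if x: "0 \<le> x" "x \<le> r" for x
  proof -
    \<comment> \<open>The logarithmic derivative of \<open>L / U\<close> is \<open>E - V\<close>,
      just shown nonnegative, and the quotient starts at 1.\<close>
    have "L 0 / U 0 \<le> L x / U x"
    proof (rule DERIV_nonneg_imp_nondecreasing[OF x(1)])
      fix y assume "0 \<le> y" "y \<le> x"
      then have y: "0 \<le> y" "y \<le> r" using x by auto
      have "((\<lambda>x. L x / U x) has_real_derivative (L y * E y * U y - L y * (U y * V y)) / (U y * U y)) (at y)"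
        using U0[OF y] by (intro DERIV_divide dL dU y) auto
      moreover have "(L y * E y * U y - L y * (U y * V y)) / (U y * U y) = L y * (E y - V y) / U y"
        using U0[OF y] by (simp add: field_simps)
      moreover have "0 \<le> L y * (E y - V y) / U y"
        using EV[OF y] L0[OF y] U0[OF y] by auto
      ultimately show "\<exists>l. ((\<lambda>x. L x / U x) has_real_derivative l) (at y) \<and> 0 \<le> l" by auto
    qed
    moreover have "L 0 = 1" "U 0 = 1" using norm by (auto simp: L_def U_def m_def)
    ultimately show ?thesis using U0[OF x] by (simp add: field_simps)
  qed
  \<comment> \<open>Since \<open>m - q 0 * f = 1\<close>, the derivative of \<open>g\<close> is d /
    m^2, whose modulus on the ray is 1 / L^2 \<le> 1 / U^2. Thus \<open>T\<close> is a majorant for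
    \<open>g\<close>.\<close>
  define g where "g z = f z / m z" for z
  have "norm (g (of_real r * e) - g (of_real 0 * e)) \<le> T r - T 0"
  proof (cases "r = 0")
    case False
    with r have "0 < r" by simp
    have g: "((\<lambda>x. g (of_real x * e)) has_vector_derivative e * (d (of_real x * e) / (m (of_real x * e))\<^sup>2)) (at x)"
      if x: "0 \<le> x" "x \<le> r" for x
    proof (rule has_vector_derivative_ray)
      let ?z = "of_real x * e"
      have "(g has_field_derivative (d ?z * m ?z - f ?z * (q 0 * d ?z)) / (m ?z * m ?z)) (at ?z)"
        unfolding g_def by (intro DERIV_divide f m ray m0 x)
      then show "(g has_field_derivative d ?z / (m ?z)\<^sup>2) (at ?z)"
        by (rule DERIV_cong) (simp add: m_def power2_eq_square algebra_simps)
    qed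
    show ?thesis
    proof (rule differentiable_bound_general[OF \<open>0 < r\<close>])
      show "continuous_on {0..r} T"
        using dT by (intro continuous_at_imp_continuous_on) (force intro: DERIV_isCont)
      show "continuous_on {0..r} (\<lambda>x. g (of_real x * e))"
        by (intro continuous_at_imp_continuous_on ballI, rule has_vector_derivative_continuous[OF g]) auto
      fix x assume "0 < x" "x < r"
      then have x: "0 \<le> x" "x \<le> r" by auto
      show "((\<lambda>x. g (of_real x * e)) has_vector_derivative e * (d (of_real x * e) / (m (of_real x * e))\<^sup>2)) (at x)"
        by (rule g[OF x])
      show "(T has_vector_derivative 1 / (U x)\<^sup>2) (at x)"
        using dT[OF x] by (simp add: has_real_derivative_iff_has_vector_derivative)
      have "(U x)\<^sup>2 \<le> (L x)\<^sup>2" using UL[OF x] U0[OF x] by (intro power_mono) auto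
      then have "1 / (L x)\<^sup>2 \<le> 1 / (U x)\<^sup>2" using U0[OF x] L0[OF x] by (intro divide_left_mono) auto
      then show "norm (e * (d (of_real x * e) / (m (of_real x * e))\<^sup>2)) \<le> 1 / (U x)\<^sup>2"
        using e by (simp add: L_def norm_mult norm_divide norm_power power_divide)
    qed
  qed simp
  also have "T r - T 0 \<le> 1 / k"
    using k tanh_real_lt_1[of "k * artanh r"] by (simp add: T_def divide_right_mono)
  finally have "norm (f (of_real r * e)) / norm (m (of_real r * e)) \<le> 1 / k"
    using norm by (simp add: g_def norm_divide)
  then show ?thesis
    using k m0[of r] r by (simp add: field_simps m_def k_def)
qed

text \<open>The radial estimate holds as long as \<open>1 + q 0 * f\<close> has no zero on the
  radius, so only such zeros have to be excluded. The estimate itself excludes a first one.\<close>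

lemma sturm_bound:
  fixes f d p q :: "complex \<Rightarrow> complex"
  assumes f: "\<And>z. z \<in> ball 0 1 \<Longrightarrow> (f has_field_derivative d z) (at z)"
    and d: "\<And>z. z \<in> ball 0 1 \<Longrightarrow> (d has_field_derivative 2 * q z * d z) (at z)"
    and d0: "\<And>z. z \<in> ball 0 1 \<Longrightarrow> d z \<noteq> 0"
    and q: "\<And>z. z \<in> ball 0 1 \<Longrightarrow> (q has_field_derivative p z + (q z)\<^sup>2) (at z)"
    and p: "\<And>z. z \<in> ball 0 1 \<Longrightarrow> norm (p z) \<le> t / (1 - (norm z)\<^sup>2)\<^sup>2"
    and norm: "f 0 = 0" "d 0 = 1" and t: "t < 1" and w: "w \<in> ball 0 1"
  shows "sqrt (1 - t) * norm (f w) \<le> norm (1 + q 0 * f w)"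
proof -
  obtain e where e: "norm e = 1" "w = of_real (norm w) * e"
    by (rule complex_polar_unit)
  define r where "r = norm w"
  have r: "0 \<le> r" "r < 1" using w by (auto simp: r_def)
  note radial = sturm_radial_bound[OF f d d0 q p norm t e(1)]
  define m where "m x = 1 + q 0 * f (of_real x * e)" for x :: real
  have contf: "isCont (\<lambda>x. f (of_real x * e)) x" if "0 \<le> x" "x \<le> r" for x :: real
  proof (rule has_vector_derivative_continuous)
    show "((\<lambda>x. f (of_real x * e)) has_vector_derivative e * d (of_real x * e)) (at x)"
      using that r e by (intro has_vector_derivative_ray f) (simp add: norm_mult)
  qed
  have contm: "isCont m x" if "0 \<le> x" "x \<le> r" for x :: real
    unfolding m_def[abs_def] by (intro continuous_add continuous_mult continuous_const contf that)
  have "m x \<noteq> 0" if "0 \<le> x" "x \<le> r" for x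
  proof
    assume "m x = 0"
    \<comment> \<open>The zeros on the radius form a compact set, so a least one exists.\<close>
    define Z where "Z = {0..r} \<inter> m -` {0}"
    have "closed Z" unfolding Z_def
      by (intro continuous_closed_preimage continuous_at_imp_continuous_on ballI contm) auto
    then have "compact ({0..r} \<inter> Z)" by (rule compact_Int_closed[OF compact_Icc])
    moreover have "{0..r} \<inter> Z = Z" unfolding Z_def by blast
    ultimately have "compact Z" by metis
    moreover have "Z \<noteq> {}" using \<open>m x = 0\<close> that by (auto simp: Z_def)
    ultimately obtain b where b: "b \<in> Z" and min: "\<And>y. y \<in> Z \<Longrightarrow> b \<le> y"
      using compact_attains_inf[of Z] by metis
    have b': "0 \<le> b" "b \<le> r" "m b = 0" using b by (auto simp: Z_def)
    \<comment> \<open>At a first zero \<open>b\<close> the bound passes to the limit and forces \<open>f = 0\<close> there, so \<open>m b = 1\<close>.\<close>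
    have "b \<noteq> 0" using b'(3) norm by (auto simp: m_def)
    with b' have "b > 0" by simp
    have below: "sqrt (1 - t) * norm (f (of_real y * e)) \<le> norm (m y)" if y: "0 < y" "y < b" for y
      unfolding m_def
    proof (rule radial)
      fix x assume x: "0 \<le> x" "x \<le> y"
      then have "x \<notin> Z" using min[of x] y by auto
      then show "1 + q 0 * f (of_real x * e) \<noteq> 0" using x y b' by (auto simp: Z_def m_def)
    qed (use y b' r in auto)
    have "((\<lambda>y. sqrt (1 - t) * norm (f (of_real y * e))) \<longlongrightarrow> sqrt (1 - t) * norm (f (of_real b * e))) (at_left b)"
      using contf[OF b'(1,2)] unfolding isCont_def
      by (intro tendsto_intros) (auto intro: tendsto_within_subset)
    moreover have "((\<lambda>y. norm (m y)) \<longlongrightarrow> norm (m b)) (at_left b)"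
      using contm[OF b'(1,2)] unfolding isCont_def
      by (intro tendsto_intros) (auto intro: tendsto_within_subset)
    moreover have "\<forall>\<^sub>F y in at_left b. sqrt (1 - t) * norm (f (of_real y * e)) \<le> norm (m y)"
      using eventually_at_left_real[OF \<open>b > 0\<close>] by (rule eventually_mono) (use below in auto)
    ultimately have "sqrt (1 - t) * norm (f (of_real b * e)) \<le> norm (m b)"
      by (intro tendsto_le[of "at_left b"]) auto
    with b' t have "f (of_real b * e) = 0"
      by (simp add: mult_le_0_iff)
    then show False using b'(3) by (simp add: m_def)
  qed
  then have "sqrt (1 - t) * norm (f (of_real r * e)) \<le> norm (1 + q 0 * f (of_real r * e))"
    by (intro radial r) (auto simp: m_def)
  then show ?thesis using e(2) by (simp add: r_def)
qed

section \<open>Combining the three estimates for a function of the Nehari class\<close>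

theorem theorem2p16:
  fixes t :: real and f :: "complex \<Rightarrow> complex" and a :: "nat \<Rightarrow> complex"
  assumes "0 \<le> t" and "t < 1"
    and "f \<in> nehari_class t"
    and "\<And>z. z \<in> unit_disc \<Longrightarrow> (\<lambda>n. a n * z ^ n) sums f z"
    and "a 0 = 0" and "a 1 = 1"
  shows "\<forall>z\<in>unit_disc.
    Re (a 2 * f z) \<ge> - (1 / 2) - t / (4 * (t + 1)) *
      (((1 + norm z) / (1 - norm z)) powr sqrt (1 + t) - 1)\<^sup>2"
proof
  fix w assume w: "w \<in> unit_disc"
  define d where "d = deriv f"
  define q where "q z = deriv d z / d z / 2" for z
  define p where "p z = schwarzian f z / 2" for z
  define s where "s = sqrt (1 + t)"
  have s: "s > 0" "s\<^sup>2 = 1 + t" using assms(1) by (auto simp: s_def)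
  have holf: "f holomorphic_on unit_disc"
    using assms(3) by (auto simp: nehari_class_def analytic_imp_holomorphic)
  then have hold: "d holomorphic_on unit_disc" and hold': "deriv d holomorphic_on unit_disc"
    by (auto simp: d_def intro!: holomorphic_deriv)
  have f: "(f has_field_derivative d z) (at z)" if "z \<in> unit_disc" for z
    unfolding d_def using holf that by (intro holomorphic_derivI) auto
  \<comment> \<open>Local univalence enters only here: an injective holomorphic function has
    nonvanishing derivative.\<close>
  have d0: "d z \<noteq> 0" if z: "z \<in> unit_disc" for z
  proof -
    obtain S where S: "open S" "z \<in> S" "S \<subseteq> unit_disc" "inj_on f S"
      using assms(3) z unfolding nehari_class_def locally_univalent_on_def by blast
    then show ?thesis
      unfolding d_def using holf by (intro holomorphic_injective_imp_regular[of f S]) (auto intro: holomorphic_on_subset)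
  qed
  have d: "(d has_field_derivative 2 * q z * d z) (at z)" if "z \<in> unit_disc" for z
    using holomorphic_derivI[OF hold _ that] d0[OF that] by (simp add: q_def)
  have q: "(q has_field_derivative p z + (q z)\<^sup>2) (at z)" if "z \<in> unit_disc" for z
  proof -
    have "(\<lambda>z. deriv d z / d z) holomorphic_on unit_disc"
      by (intro holomorphic_intros hold hold' d0)
    from holomorphic_derivI[OF this _ that]
    have "((\<lambda>z. deriv d z / d z) has_field_derivative deriv (\<lambda>z. deriv d z / d z) z) (at z)" by simp
    from DERIV_cdivide[OF this, of 2]
    have "(q has_field_derivative deriv (\<lambda>z. deriv d z / d z) z / 2) (at z)"
      by (simp add: q_def[abs_def])
    then show ?thesis
      by (rule DERIV_cong) (simp add: p_def q_def schwarzian_def d_def power2_eq_square field_simps)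
  qed
  have p: "norm (p z) \<le> t / (1 - (norm z)\<^sup>2)\<^sup>2" if "z \<in> unit_disc" for z
  proof -
    have "norm (schwarzian f z) \<le> 2 * t / (1 - (norm z)\<^sup>2)\<^sup>2"
      using assms(3) that unfolding nehari_class_def by blast
    then show ?thesis by (simp add: p_def norm_divide mult.commute)
  qed
  \<comment> \<open>Uniqueness of power series identifies \<open>a\<close> with the Taylor
    coefficients, whence \<open>a 2\<close> is half of f''(0), which is \<open>q 0\<close> because
    \<open>d 0 = 1\<close>.\<close>
  have "f has_fps_expansion Abs_fps a"
    using eventually_nhds_in_open[of unit_disc 0] assms(4)
    by (intro has_fps_expansionI) (auto elim!: eventually_mono)
  from fps_nth_fps_expansion[OF this]
  have coeff: "a n = (deriv ^^ n) f 0 / fact n" for n by simp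
  have f0: "f 0 = 0" and d1: "d 0 = 1" and a2: "a 2 = q 0"
    using coeff[of 0] coeff[of 1] coeff[of 2] assms(5,6)
    by (auto simp: d_def q_def numeral_2_eq_2)
  \<comment> \<open>Used twice: at all points for the growth estimate, and at the origin for |a_2|
    \<le> s.\<close>
  have bound: "norm (of_real (1 - (norm z)\<^sup>2) * q z - cnj z) \<le> s" if "z \<in> unit_disc" for z
    unfolding s_def by (rule riccati_bound_disc[OF q p assms(1) that])
  define F where "F = (((1 + norm w) / (1 - norm w)) powr s - 1) / (2 * s)"
  have "norm (f w) \<le> F"
    unfolding F_def by (rule norm_le_growth[OF f d d0 bound f0 d1 s(1) w])
  then have growth: "(norm (f w))\<^sup>2 \<le> F\<^sup>2" by (intro power_mono) auto
  have "norm (a 2) \<le> s" using bound[of 0] by (simp add: a2)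
  then have "(norm (a 2))\<^sup>2 \<le> s\<^sup>2" by (intro power_mono) auto
  then have order: "(norm (a 2))\<^sup>2 \<le> 1 + t" by (simp add: s)
  have "sqrt (1 - t) * norm (f w) \<le> norm (1 + a 2 * f w)"
    unfolding a2 by (rule sturm_bound[OF f d d0 q p f0 d1 assms(2) w])
  then have "(sqrt (1 - t) * norm (f w))\<^sup>2 \<le> (norm (1 + a 2 * f w))\<^sup>2"
    using assms(2) by (intro power_mono) auto
  then have sturm: "(1 - t) * (norm (f w))\<^sup>2 \<le> (norm (1 + a 2 * f w))\<^sup>2"
    using assms(2) by (simp add: power_mult_distrib)
  \<comment> \<open>Expanding the square isolates Re (a_2 f). The coefficients of |f|^2 combine to
    (1 - t) - (1 + t) = -2 t, and halving gives -1/2 - t |f|^2 as lower bound.\<close>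
  have "(norm (1 + a 2 * f w))\<^sup>2 = 1 + 2 * Re (a 2 * f w) + (norm (a 2 * f w))\<^sup>2"
    unfolding cmod_power2 by (simp add: power2_eq_square algebra_simps)
  also have "(norm (a 2 * f w))\<^sup>2 \<le> (1 + t) * (norm (f w))\<^sup>2"
    using mult_right_mono[OF order] by (simp add: norm_mult power_mult_distrib)
  finally have "(1 - t) * (norm (f w))\<^sup>2 \<le> 1 + 2 * Re (a 2 * f w) + (1 + t) * (norm (f w))\<^sup>2"
    using sturm by linarith
  then have "- (1 / 2) - t * (norm (f w))\<^sup>2 \<le> Re (a 2 * f w)"
    by (simp add: algebra_simps)
  moreover have "t * (norm (f w))\<^sup>2 \<le> t * F\<^sup>2"
    using growth assms(1) by (intro mult_left_mono) auto
  \<comment> \<open>The factor 1 / (2 s)^2 equals 1 / (4 (t + 1)) because s^2 = 1 + t.\<close>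
  moreover have "t * F\<^sup>2 = t / (4 * (t + 1)) * (((1 + norm w) / (1 - norm w)) powr s - 1)\<^sup>2"
    unfolding F_def power_divide power_mult_distrib s(2) by (simp add: add.commute)
  ultimately show "Re (a 2 * f w) \<ge> - (1 / 2) - t / (4 * (t + 1)) *
      (((1 + norm w) / (1 - norm w)) powr sqrt (1 + t) - 1)\<^sup>2"
    unfolding s_def by linarith
qed

end
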